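(* For any table (regular hypersurface) $\Sigma\subset(\mathbb{RP}^3,\xi)$, the associated outer contact billiard correspondence admits no non-collinear $3$-periodic orbits.
   Context: Let $(\mathbb{R}^4,\omega)$ be a 4-dimensional real symplectic vector space and $\mathbb{RP}^3$ the space of lines through the origin of $\mathbb{R}^4$, with contact structure $\xi_q=q^\omega$, where $W^\omega$ denotes the $\omega$-orthogonal complement of a subspace $W$. For a regular hypersurface $\Sigma\subset\mathbb{RP}^3$ and $q\in\Sigma$, put $q'=(T_q\Sigma)^\omega\in\mathbb{RP}^3$, where $T_q\Sigma$ is the projective tangent plane viewed as a hyperplane of $\mathbb{R}^4$; when $q'\neq q$ the characteristic line at $q$ is the projective line through $q$ and $q'$. Collinear points $C,D$ are harmonic conjugates with respect to distinct points $A,B$ if there are lifts with $\mathbf C=\mathbf A+\mathbf B$, $\mathbf D=\mathbf A-\mathbf B$. Points $Z,Z'$ are in outer contact billiard correspondence over $\Sigma$ if there is $q\in\Sigma$ (with $q'\ne q$) such that the line through $Z,Z'$ is the characteristic line at $q$ and $Z,Z'$ are harmonic conjugates with respect to $q,q'$. An orbit is a sequence $(Z_j)_{j\in\mathbb{Z}}$ such that each consecutive pair $Z_j,Z_{j+1}$ is in correspondence; it is periodic if $Z_{j+k}=Z_j$ for all $j$ for some positive integer $k$, and the smallest such $k$ is its period ($k$-periodic orbit). An orbit is collinear if all its points lie on one projective line. *)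

theory Defs
  imports "HOL-Analysis.Analysis"
begin

definition symplectic_form :: "(real^4 \<Rightarrow> real^4 \<Rightarrow> real) \<Rightarrow> bool" where
  "symplectic_form \<omega> \<longleftrightarrow>
     bilinear \<omega> \<and> (\<forall>x. \<omega> x x = 0) \<and> (\<forall>x. (\<forall>y. \<omega> x y = 0) \<longrightarrow> x = 0)"

definition sympl_orth :: "(real^4 \<Rightarrow> real^4 \<Rightarrow> real) \<Rightarrow> (real^4) set \<Rightarrow> (real^4) set" where
  "sympl_orth \<omega> W = {x. \<forall>w\<in>W. \<omega> w x = 0}"

definition RP3 :: "(real^4) set set" where
  "RP3 = {L. subspace L \<and> dim L = 1}"

text \<open>The preimage of a set of points of projective space under the quotient map
  sending a nonzero vector v to the line spanned by v.\<close>

definition lifts :: "(real^4) set set \<Rightarrow> (real^4) set" where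
  "lifts S = {v. v \<noteq> 0 \<and> span {v} \<in> S}"

text \<open>Quotient topology.\<close>

definition open_RP3 :: "(real^4) set set \<Rightarrow> bool" where
  "open_RP3 U \<longleftrightarrow> U \<subseteq> RP3 \<and> open (lifts U)"

text \<open>The differentiable structure of projective space is that of the quotient of the
  nonzero vectors: a function F on an open set U of points is continuously differentiable iff
  its pullback to the lifts of U is, and since the quotient map is a submersion, dF is nonzero
  at a point iff the differential of the pullback is nonzero at its lifts. A regular
  hypersurface is locally a regular level set of such a function. Only class C^1 is required,
  so hypersurfaces of every higher class, in particular smooth ones, are included.
  The vector G v is the gradient of the pullback at v.\<close>

definition regular_hypersurface :: "(real^4) set set \<Rightarrow> bool" where
  "regular_hypersurface \<Sigma> \<longleftrightarrow> \<Sigma> \<subseteq> RP3 \<and>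
     (\<forall>q\<in>\<Sigma>. \<exists>U (F :: (real^4) set \<Rightarrow> real) (G :: real^4 \<Rightarrow> real^4).
        open_RP3 U \<and> q \<in> U \<and>
        (\<forall>v\<in>lifts U. ((\<lambda>x. F (span {x})) has_derivative (\<lambda>h. G v \<bullet> h)) (at v)) \<and>
        continuous_on (lifts U) G \<and>
        \<Sigma> \<inter> U = {p\<in>U. F p = 0} \<and>
        (\<forall>v\<in>lifts (\<Sigma> \<inter> U). G v \<noteq> 0))"

text \<open>The projective tangent plane as a hyperplane of the ambient vector space: the
  velocities, at lifts of q, of lifted curves in the hypersurface. It is the kernel of the
  differential of the pulled-back local defining function and contains the line q.\<close>

definition tangent_hyperplane :: "(real^4) set set \<Rightarrow> (real^4) set \<Rightarrow> (real^4) set" where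
  "tangent_hyperplane \<Sigma> q =
     {w. \<exists>\<gamma> :: real \<Rightarrow> real^4. \<gamma> 0 \<in> lifts {q} \<and>
           (\<forall>\<^sub>F t in nhds 0. \<gamma> t \<in> lifts \<Sigma>) \<and>
           (\<gamma> has_vector_derivative w) (at 0)}"

text \<open>The point q': a line, since the tangent hyperplane of a regular hypersurface has dimension 3.\<close>

definition char_point ::
  "(real^4 \<Rightarrow> real^4 \<Rightarrow> real) \<Rightarrow> (real^4) set set \<Rightarrow> (real^4) set \<Rightarrow> (real^4) set" where
  "char_point \<omega> \<Sigma> q = sympl_orth \<omega> (tangent_hyperplane \<Sigma> q)"

text \<open>The projective line through two points, as a set of points; meaningful for A and B
  distinct.\<close>

definition proj_line :: "(real^4) set \<Rightarrow> (real^4) set \<Rightarrow> (real^4) set set" where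
  "proj_line A B = {P\<in>RP3. P \<subseteq> span (A \<union> B)}"

definition char_line ::
  "(real^4 \<Rightarrow> real^4 \<Rightarrow> real) \<Rightarrow> (real^4) set set \<Rightarrow> (real^4) set \<Rightarrow> (real^4) set set" where
  "char_line \<omega> \<Sigma> q = proj_line q (char_point \<omega> \<Sigma> q)"

text \<open>The points C and D are harmonic conjugates with respect to A and B; the vectors a, b,
  a + b, a - b are lifts of A, B, C, D (in particular A, B, C, D are collinear).\<close>

definition harmonic_conjugates ::
  "(real^4) set \<Rightarrow> (real^4) set \<Rightarrow> (real^4) set \<Rightarrow> (real^4) set \<Rightarrow> bool" where
  "harmonic_conjugates A B C D \<longleftrightarrow> A \<noteq> B \<and>
     (\<exists>a b. a \<in> lifts {A} \<and> b \<in> lifts {B} \<and> a + b \<in> lifts {C} \<and> a - b \<in> lifts {D})"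

definition outer_contact_corr ::
  "(real^4 \<Rightarrow> real^4 \<Rightarrow> real) \<Rightarrow> (real^4) set set \<Rightarrow> (real^4) set \<Rightarrow> (real^4) set \<Rightarrow> bool" where
  "outer_contact_corr \<omega> \<Sigma> Z Z' \<longleftrightarrow> Z \<in> RP3 \<and> Z' \<in> RP3 \<and>
     (\<exists>q\<in>\<Sigma>. char_point \<omega> \<Sigma> q \<noteq> q \<and>
        Z \<noteq> Z' \<and> proj_line Z Z' = char_line \<omega> \<Sigma> q \<and>
        harmonic_conjugates q (char_point \<omega> \<Sigma> q) Z Z')"

definition billiard_orbit ::
  "(real^4 \<Rightarrow> real^4 \<Rightarrow> real) \<Rightarrow> (real^4) set set \<Rightarrow> (int \<Rightarrow> (real^4) set) \<Rightarrow> bool" where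
  "billiard_orbit \<omega> \<Sigma> Z \<longleftrightarrow> (\<forall>j. outer_contact_corr \<omega> \<Sigma> (Z j) (Z (j + 1)))"

definition has_minimal_period :: "(int \<Rightarrow> 'a) \<Rightarrow> nat \<Rightarrow> bool" where
  "has_minimal_period Z k \<longleftrightarrow> 0 < k \<and> (\<forall>j. Z (j + int k) = Z j) \<and>
     (\<forall>m. 0 < m \<and> (\<forall>j. Z (j + int m) = Z j) \<longrightarrow> k \<le> m)"

definition periodic_orbit ::
  "(real^4 \<Rightarrow> real^4 \<Rightarrow> real) \<Rightarrow> (real^4) set set \<Rightarrow> nat \<Rightarrow> (int \<Rightarrow> (real^4) set) \<Rightarrow> bool" where
  "periodic_orbit \<omega> \<Sigma> k Z \<longleftrightarrow> billiard_orbit \<omega> \<Sigma> Z \<and> has_minimal_period Z k"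

definition collinear_orbit :: "(int \<Rightarrow> (real^4) set) \<Rightarrow> bool" where
  "collinear_orbit Z \<longleftrightarrow>
     (\<exists>A\<in>RP3. \<exists>B\<in>RP3. A \<noteq> B \<and> (\<forall>j. Z j \<in> proj_line A B))"

end

(* A characteristic line is isotropic: the point q lies in its own tangent hyperplane, hence
   is omega-orthogonal to q'. Consecutive points of an orbit lie on such a line, so three
   non-collinear points of a 3-periodic orbit would be pairwise omega-orthogonal and span a
   3-dimensional isotropic subspace of the 4-dimensional symplectic space. *)

theory Submission imports Defs
begin

lemma bilinear_alternating_skew:
  assumes "bilinear \<omega>" and alt: "\<And>x. \<omega> x x = 0"
  shows "\<omega> y x = - (\<omega> x y :: 'b::real_vector)"
proof -
  have "\<omega> y x + \<omega> x y = \<omega> (y + x) (y + x)"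
    unfolding bilinear_ladd[OF assms(1)] bilinear_radd[OF assms(1)] by (simp add: alt)
  then show ?thesis
    by (simp add: alt eq_neg_iff_add_eq_0)
qed

lemma dim_isotropic_le:
  fixes \<omega> :: "'a::euclidean_space \<Rightarrow> 'a \<Rightarrow> real"
  assumes bil: "bilinear \<omega>"
    and nondeg: "\<And>x. (\<And>y. \<omega> x y = 0) \<Longrightarrow> x = 0"
    and isotropic: "\<And>x y. x \<in> S \<Longrightarrow> y \<in> S \<Longrightarrow> \<omega> x y = 0"
  shows "2 * dim S \<le> DIM('a)"
proof -
  \<comment> \<open>The Riesz vector of the functional \<open>\<omega> x\<close>: the adjoint of a
    map into the reals, evaluated at 1.\<close>
  define A where "A x = adjoint (\<omega> x) 1" for x
  have A: "A x \<bullet> y = \<omega> x y" for x y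
    using adjoint_works[of "\<omega> x" y 1] bil by (simp add: A_def bilinear_def inner_commute)
  have lin: "linear A"
  proof (rule linearI)
    show "A (x + y) = A x + A y" for x y
      by (rule vector_eq_rdot[THEN iffD1])
        (simp add: A inner_add_left bilinear_ladd[OF bil])
    show "A (c *\<^sub>R x) = c *\<^sub>R A x" for c x
      by (rule vector_eq_rdot[THEN iffD1])
        (simp add: A bilinear_lmul[OF bil])
  qed
  have "inj A"
    unfolding linear_injective_0[OF lin] using nondeg by (metis A inner_zero_left)
  then have "dim (A ` S) = dim S"
    using lin by (intro dim_image_eq) (auto intro: inj_on_subset)
  moreover have "dim (A ` S \<union> S) = dim (A ` S) + dim S"
    by (rule dim_orthogonal_sum) (auto simp: A isotropic)
  ultimately show ?thesis
    using dim_subset_UNIV[of "A ` S \<union> S"] by simp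
qed

lemma RP3_lift:
  assumes "Z \<in> RP3"
  obtains z where "z \<in> lifts {Z}"
proof -
  obtain B where B: "B \<subseteq> Z" "independent B" "Z \<subseteq> span B" "card B = 1"
    using assms basis_exists[of Z] unfolding RP3_def by (metis (lifting) mem_Collect_eq)
  then obtain z where z: "B = {z}"
    by (meson card_1_singletonE)
  moreover have "span {z} = Z"
    using B z assms by (intro antisym span_minimal) (auto simp: RP3_def)
  ultimately show thesis
    using that[of z] B(2) by (auto simp: lifts_def dest: dependent_zero)
qed

lemma lifts_singletonD:
  assumes "z \<in> lifts {Z}"
  shows "z \<noteq> 0" "span {z} = Z" "z \<in> Z"
  using assms span_base[of z "{z}"] by (auto simp: lifts_def)

lemma mem_span_singleton:
  assumes "x \<in> span {z}"
  obtains c :: real where "x = c *\<^sub>R z"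
  using assms by (auto simp: span_singleton)

lemma lift_in_tangent_hyperplane:
  assumes "q \<in> \<Sigma>" "a \<in> lifts {q}"
  shows "a \<in> tangent_hyperplane \<Sigma> q"
proof -
  \<comment> \<open>Moving a lift within its own line is a curve with velocity in that line.\<close>
  let ?\<gamma> = "\<lambda>t::real. (1 + t) *\<^sub>R a"
  \<comment> \<open>For t > -1 the factor 1 + t is nonzero, so the curve stays among the lifts of
    \<open>q\<close>.\<close>
  have "\<forall>\<^sub>F t in nhds (0::real). t \<in> {-1<..}"
    by (intro eventually_nhds_in_open) auto
  then have "\<forall>\<^sub>F t in nhds 0. ?\<gamma> t \<in> lifts \<Sigma>"
  proof eventually_elim
    case (elim t)
    then have "span {?\<gamma> t} = span {a}"
      using span_image_scale[of "{a}" "\<lambda>_. 1 + t"] by simp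
    then show ?case
      using elim assms by (auto simp: lifts_def)
  qed
  moreover have "(?\<gamma> has_vector_derivative a) (at 0)"
    by (auto intro!: derivative_eq_intros)
  ultimately show ?thesis
    using assms(2) by (auto simp: tangent_hyperplane_def intro!: exI[of _ ?\<gamma>])
qed

text \<open>The harmonic lifts have the form a + b and a - b, with a on \<open>q\<close> and b on
  the characteristic point. Since a is tangent and b lies in the \<open>\<omega>\<close>-complement
  of the tangent hyperplane, \<omega> a b = 0, and \<omega> (a + b) (a - b) = -2 \<omega> a
  b.\<close>

lemma outer_contact_corr_orthogonal:
  assumes \<omega>: "symplectic_form \<omega>" and corr: "outer_contact_corr \<omega> \<Sigma> Z Z'"
    and x: "x \<in> Z" and y: "y \<in> Z'"
  shows "\<omega> x y = 0"
proof -
  have bil: "bilinear \<omega>" and alt: "\<And>x. \<omega> x x = 0"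
    using \<omega> by (auto simp: symplectic_form_def)
  obtain q a b where q: "q \<in> \<Sigma>" and a: "a \<in> lifts {q}"
    and b: "b \<in> lifts {char_point \<omega> \<Sigma> q}"
    and ab: "a + b \<in> lifts {Z}" "a - b \<in> lifts {Z'}"
    using corr by (auto simp: outer_contact_corr_def harmonic_conjugates_def)
  have 0: "\<omega> a b = 0"
    using lifts_singletonD(3)[OF b] lift_in_tangent_hyperplane[OF q a]
    by (auto simp: char_point_def sympl_orth_def)
  have "\<omega> (a + b) (a - b) = 0"
    using 0 bilinear_alternating_skew[OF bil alt, of b a]
    by (simp add: alt bilinear_ladd[OF bil] bilinear_rsub[OF bil])
  moreover obtain c d where "x = c *\<^sub>R (a + b)" "y = d *\<^sub>R (a - b)"
    using x y lifts_singletonD(2)[OF ab(1)] lifts_singletonD(2)[OF ab(2)]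
    by (metis mem_span_singleton)
  ultimately show ?thesis
    by (simp add: bilinear_lmul[OF bil] bilinear_rmul[OF bil])
qed

text \<open>Translates projective non-collinearity into linear independence of lifts, the form in
  which the dimension bound for isotropic sets applies.\<close>

lemma dim_three_lifts:
  assumes x: "x \<in> lifts {X}" and y: "y \<in> lifts {Y}" and z: "z \<in> lifts {Z}"
    and "X \<noteq> Y" and not_on_line: "\<not> Z \<subseteq> span (X \<union> Y)"
  shows "dim {x, y, z} = 3"
proof -
  note xyz = lifts_singletonD[OF x] lifts_singletonD[OF y] lifts_singletonD[OF z]
  have "x \<notin> span {y}"
  proof
    assume "x \<in> span {y}"
    then obtain c where c: "x = c *\<^sub>R y"
      by (rule mem_span_singleton)
    then have "span {x} = span {y}"
      using xyz(1) span_image_scale[of "{y}" "\<lambda>_. c"] by auto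
    then show False
      using xyz \<open>X \<noteq> Y\<close> by simp
  qed
  moreover have "z \<notin> span {x, y}"
  proof
    assume "z \<in> span {x, y}"
    also have "\<dots> \<subseteq> span (X \<union> Y)"
      using xyz by (intro span_mono) auto
    finally have "span {z} \<subseteq> span (X \<union> Y)"
      by (intro span_minimal) auto
    then show False
      using not_on_line xyz by simp
  qed
  ultimately have "dim {z, x, y} = 3"
    using xyz(4) by (simp add: dim_insert)
  then show ?thesis
    by (simp add: insert_commute)
qed

theorem proposition4p1:
  fixes \<omega> :: "real^4 \<Rightarrow> real^4 \<Rightarrow> real" and \<Sigma> :: "(real^4) set set"
  assumes "symplectic_form \<omega>"
    and "regular_hypersurface \<Sigma>"
  shows "\<not> (\<exists>Z. periodic_orbit \<omega> \<Sigma> 3 Z \<and> \<not> collinear_orbit Z)"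
proof (intro notI, elim exE conjE)
  fix Z assume per: "periodic_orbit \<omega> \<Sigma> 3 Z" and noncol: "\<not> collinear_orbit Z"
  have bil: "bilinear \<omega>" and alt: "\<And>x. \<omega> x x = 0"
    and nondeg: "\<And>x. (\<And>y. \<omega> x y = 0) \<Longrightarrow> x = 0"
    using assms(1) by (auto simp: symplectic_form_def)
  note skew = bilinear_alternating_skew[OF bil alt]
  have corr: "outer_contact_corr \<omega> \<Sigma> (Z j) (Z (j + 1))" for j
    using per by (simp add: periodic_orbit_def billiard_orbit_def)
  have Z3: "Z (j + 3) = Z j" for j
    using per by (simp add: periodic_orbit_def has_minimal_period_def)
  have RP: "Z j \<in> RP3" for j
    using corr[of j] by (auto simp: outer_contact_corr_def)
  have ne: "Z 0 \<noteq> Z 1"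
    using corr[of 0] by (simp add: outer_contact_corr_def) blast
  have vertex: "Z j \<in> {Z 0, Z 1, Z 2}" for j
  proof -
    \<comment> \<open>The shift \<open>n\<close> is natural, so it only moves forward: from
      \<open>j mod 3\<close> up to \<open>j\<close> when the quotient is nonnegative, and from
      \<open>j\<close> up to \<open>j mod 3\<close> when it is negative.\<close>
    have up: "Z (i + 3 * int n) = Z i" for i n
      by (induction n) (use Z3[of "i + 3 * int _"] in \<open>auto simp: algebra_simps\<close>)
    have "Z j = Z (j mod 3)"
    proof (cases "0 \<le> j div 3")
      case True
      then show ?thesis
        using up[of "j mod 3" "nat (j div 3)"] by simp
    next
      case False
      then show ?thesis
        using up[of j "nat (- (j div 3))"] by (simp add: minus_mult_div_eq_mod)
    qed
    moreover have "j mod 3 = 0 \<or> j mod 3 = 1 \<or> j mod 3 = 2"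
      by presburger
    ultimately show ?thesis
      by (metis insertCI)
  qed
  \<comment> \<open>Otherwise the line through \<open>Z 0\<close> and \<open>Z 1\<close> would
    contain all three vertices, hence the whole orbit.\<close>
  have "\<not> Z 2 \<subseteq> span (Z 0 \<union> Z 1)"
  proof
    assume "Z 2 \<subseteq> span (Z 0 \<union> Z 1)"
    moreover have "Z 0 \<subseteq> span (Z 0 \<union> Z 1)" "Z 1 \<subseteq> span (Z 0 \<union> Z 1)"
      using span_superset[of "Z 0 \<union> Z 1"] by auto
    ultimately have "Z j \<in> proj_line (Z 0) (Z 1)" for j
      using vertex[of j] RP by (auto simp: proj_line_def)
    then show False
      using noncol RP ne unfolding collinear_orbit_def by blast
  qed
  moreover obtain x y z where xyz: "x \<in> lifts {Z 0}" "y \<in> lifts {Z 1}" "z \<in> lifts {Z 2}"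
    using RP RP3_lift by metis
  ultimately have "dim {x, y, z} = 3"
    using ne by (intro dim_three_lifts)
  \<comment> \<open>Period 3 closes the triangle: the third correspondence joins \<open>Z 2\<close>
    to \<open>Z 3 = Z 0\<close>, so every pair of vertices is consecutive.\<close>
  moreover have "\<omega> x y = 0" "\<omega> y z = 0" "\<omega> z x = 0"
    using outer_contact_corr_orthogonal[OF assms(1) corr[of 0]]
      outer_contact_corr_orthogonal[OF assms(1) corr[of 1]]
      outer_contact_corr_orthogonal[OF assms(1) corr[of 2]]
      Z3[of 0] xyz[THEN lifts_singletonD(3)] by auto
  \<comment> \<open>Isotropy concerns all ordered pairs: \<open>alt\<close> covers the diagonal and
    \<open>skew\<close> the reversed pairs. With dimension 3 the bound reads 6 \<le> 4.\<close>
  then have "2 * dim {x, y, z} \<le> DIM(real^4)"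
    by (intro dim_isotropic_le[OF bil nondeg])
      (auto simp: alt skew[of y x] skew[of z y] skew[of x z])
  ultimately show False
    by simp
qed

end
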